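(* Let $\mathcal{H}$ be a real Hilbert space with $\dim \mathcal{H} \geq 2$, and let $\Omega:\mathcal{H} \rightarrow \mathbb{R}\cup\{+\infty\}$ be a lower semicontinuous function. Then the following two conditions are equivalent: (i) there exists a nondecreasing function $h:\mathbb{R}\rightarrow\mathbb{R}\cup\{+\infty\}$ such that $\Omega(w) = h(\|w\|)$ for all $w\in\mathcal{H}$; (ii) for all $x,y\in\mathcal{H}$ with $\langle x,y\rangle = 0$, $$\Omega(x+y) \geq \max\{\Omega(x),\Omega(y)\}.$$
   Context: $\langle\cdot,\cdot\rangle$ and $\|\cdot\|$ denote the inner product and norm of $\mathcal{H}$. The space $\mathcal{H}$ may be finite- or infinite-dimensional. Lower semicontinuity is with respect to the norm topology, and $\mathbb{R}\cup\{+\infty\}$ carries its usual order. *)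

theory Defs
  imports "HOL-Analysis.Analysis"
begin

(* The library function dim is 0 on spaces without a finite basis, so "dimension at least n"
   is stated through a possibly infinite Hamel basis. *)
definition dim_at_least :: "nat \<Rightarrow> 'a::real_vector set \<Rightarrow> bool" where
  "dim_at_least n V \<longleftrightarrow>
     (\<exists>B. independent B \<and> span B = span V \<and> (finite B \<longrightarrow> n \<le> card B))"

definition lower_semicontinuous ::
    "('a::topological_space \<Rightarrow> 'b::{complete_linorder,linorder_topology}) \<Rightarrow> bool" where
  "lower_semicontinuous f \<longleftrightarrow> (\<forall>x. f x \<le> Liminf (at x) f)"

end

theory Submission
  imports Defs
begin

text \<open>
  If \<open>u\<close> is orthogonal to \<open>v - u\<close>, condition (ii) gives \<open>\<Omega> u \<le> \<Omega> v\<close>. Turning a vector by an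
  angle \<open>d\<close> while dividing its length by \<open>cos d\<close> is such a step. Splitting a rotation by \<open>\<theta>\<close> into
  \<open>n\<close> equal steps stretches the vector only by \<open>cos (\<theta> / n) ^ - n\<close>, which tends to 1. Hence
  \<open>\<Omega> x \<le> \<Omega> y\<close> whenever \<open>norm x < norm y\<close>, and lower semicontinuity extends this to vectors of
  equal norm.
\<close>

section \<open>Polar coordinates in a plane, and powers of cosines\<close>

lemma ex_not_in_span_singleton:
  fixes e :: "'a::real_vector"
  assumes "dim_at_least 2 (UNIV :: 'a set)"
  shows "\<exists>u. u \<notin> span {e}"
proof (rule ccontr)
  assume "\<not> ?thesis"
  then have "B \<subseteq> span {e}" for B
    by blast
  moreover obtain B :: "'a set" where B: "independent B" "finite B \<longrightarrow> 2 \<le> card B"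
    using assms unfolding dim_at_least_def by blast
  \<comment> \<open>An independent set inside a line has at most one element, which contradicts the
    size of the Hamel basis \<open>B\<close>.\<close>
  ultimately have "finite B \<and> card B \<le> card {e}"
    by (intro independent_span_bound) simp_all
  with B(2) show False
    by simp
qed

text \<open>Gram-Schmidt: \<open>f\<close> is the normalised component orthogonal to
  \<open>e\<close> of a vector \<open>u\<close> off the line through \<open>e\<close>.\<close>

lemma ex_orthogonal_unit_in_plane:
  fixes e y :: "'a::real_inner"
  assumes dim: "dim_at_least 2 (UNIV :: 'a set)" and e: "norm e = 1"
  obtains f \<alpha> \<beta> where "norm f = 1" "e \<bullet> f = 0" "y = \<alpha> *\<^sub>R e + \<beta> *\<^sub>R f"
proof -
  have ee: "e \<bullet> e = 1"
    using e by (simp add: norm_eq_1)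
  \<comment> \<open>Take \<open>u = y\<close> if \<open>y\<close> is off the line; otherwise any
    \<open>u\<close> off the line will do, with \<beta> = 0.\<close>
  obtain u where u: "u \<notin> span {e}" and yu: "y \<in> span {e} \<or> u = y"
    using ex_not_in_span_singleton[OF dim, of e] by blast
  define z where "z = u - (e \<bullet> u) *\<^sub>R e"
  define f where "f = z /\<^sub>R norm z"
  have z0: "z \<noteq> 0"
    using u by (auto simp: z_def span_singleton)
  have uz: "u = (e \<bullet> u) *\<^sub>R e + norm z *\<^sub>R f"
    using z0 by (simp add: f_def z_def)
  have "e \<bullet> z = 0"
    by (simp add: z_def inner_diff_right ee)
  then have f: "norm f = 1" "e \<bullet> f = 0"
    using z0 by (simp_all add: f_def)
  from yu show ?thesis
  proof
    assume "y \<in> span {e}"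
    then obtain k where "y = k *\<^sub>R e"
      by (auto simp: span_singleton)
    then show ?thesis
      using that[OF f, of k 0] by simp
  next
    assume "u = y"
    then show ?thesis
      using that[OF f] uz by metis
  qed
qed

definition polar :: "'a::real_vector \<Rightarrow> 'a \<Rightarrow> real \<Rightarrow> real \<Rightarrow> 'a" where
  "polar e f r t = r *\<^sub>R (cos t *\<^sub>R e + sin t *\<^sub>R f)"

lemma polar_form_in_plane:
  fixes e y :: "'a::real_inner"
  assumes dim: "dim_at_least 2 (UNIV :: 'a set)" and e: "norm e = 1"
  obtains f \<theta> where "norm f = 1" "e \<bullet> f = 0"
    "y = polar e f (norm y) \<theta>"
proof -
  obtain f \<alpha> \<beta> where f: "norm f = 1" "e \<bullet> f = 0" and y: "y = \<alpha> *\<^sub>R e + \<beta> *\<^sub>R f"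
    using ex_orthogonal_unit_in_plane[OF dim e] by metis
  have "y \<bullet> y = \<alpha>\<^sup>2 + \<beta>\<^sup>2"
    using e f by (simp add: y inner_add inner_commute[of f e] norm_eq_1 power2_eq_square)
  then have n: "(norm y)\<^sup>2 = \<alpha>\<^sup>2 + \<beta>\<^sup>2"
    by (simp add: power2_norm_eq_inner)
  show ?thesis
  proof (cases "y = 0")
    case True
    then show ?thesis using that[OF f, of 0] by (simp add: polar_def)
  next
    case False
    then have "(\<alpha> / norm y)\<^sup>2 + (\<beta> / norm y)\<^sup>2 = 1"
      by (simp add: power_divide n[symmetric] flip: add_divide_distrib)
    then obtain t where t: "\<alpha> / norm y = cos t" "\<beta> / norm y = sin t"
      using sincos_total_2pi by metis
    then have "norm y * cos t = \<alpha>" "norm y * sin t = \<beta>"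
      using False by (auto simp: field_simps)
    then have "\<alpha> *\<^sub>R e + \<beta> *\<^sub>R f = polar e f (norm y) t"
      by (simp add: polar_def scaleR_add_right)
    with y have "y = polar e f (norm y) t"
      by (rule trans)
    then show ?thesis using that[OF f] by blast
  qed
qed

text \<open>For \<open>d = \<theta> / n\<close>, the bound
  \<open>cos d \<ge> 1 - d\<^sup>2 / 2\<close> and Bernoulli's inequality give
  \<open>cos d ^ n \<ge> 1 - \<theta>\<^sup>2 / (2 * n)\<close>, which tends to 1.\<close>

lemma ex_cos_divide_power_ge:
  fixes q \<theta> :: real
  assumes "q < 1"
  shows "\<exists>n>0. \<bar>\<theta> / real n\<bar> \<le> 1 \<and> q \<le> cos (\<theta> / real n) ^ n"
proof -
  \<comment> \<open>Both summands are nonnegative: the first forces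
    \<open>\<bar>d\<bar> \<le> 1\<close>, the second
    \<open>\<theta>\<^sup>2 / (2 * n) \<le> 1 - q\<close>.\<close>
  obtain n where n: "\<bar>\<theta>\<bar> + \<theta>\<^sup>2 / (2 * (1 - q)) < real n"
    using reals_Archimedean2 by blast
  define d where "d = \<theta> / real n"
  have "0 \<le> \<theta>\<^sup>2 / (2 * (1 - q))"
    using assms by simp
  then have n\<theta>: "\<bar>\<theta>\<bar> < real n" and n2: "\<theta>\<^sup>2 / (2 * (1 - q)) < real n"
    using n by linarith+
  then have n0: "0 < n"
    by (cases n) auto
  have d1: "\<bar>d\<bar> \<le> 1"
    using n\<theta> n0 by (simp add: d_def abs_divide)
  then have d2: "d\<^sup>2 \<le> 1"
    by (simp add: abs_square_le_1)
  have "d\<^sup>2 / 2 = 2 * (d / 2)\<^sup>2"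
    by (simp add: power2_eq_square)
  also have "\<dots> \<ge> 2 * (sin (d / 2))\<^sup>2"
    using abs_sin_x_le_abs_x[of "d / 2"] by (simp only: abs_le_square_iff)
  finally have cos_ge: "1 - d\<^sup>2 / 2 \<le> cos d"
    using cos_double_sin[of "d / 2"] by simp
  have "\<theta>\<^sup>2 / (2 * real n) \<le> 1 - q"
    using n2 assms n0 by (simp add: field_simps)
  then have "q \<le> 1 + real n * (- d\<^sup>2 / 2)"
    using n0 by (simp add: d_def power2_eq_square)
  also have "\<dots> \<le> (1 + (- d\<^sup>2 / 2)) ^ n"
    using d2 by (intro Bernoulli_inequality) linarith
  also have "\<dots> \<le> cos d ^ n"
    using d2 cos_ge by (intro power_mono) auto
  finally show ?thesis
    using n0 d1 by (auto simp: d_def)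
qed

lemma lower_semicontinuousD:
  assumes "lower_semicontinuous f" "c < f x"
  shows "eventually (\<lambda>z. c < f z) (at x)"
proof -
  have "c < Liminf (at x) f"
    using assms by (auto simp: lower_semicontinuous_def intro: less_le_trans)
  then show ?thesis
    by (rule less_LiminfD)
qed

lemma inner_polar:
  assumes "norm e = 1" "norm f = 1" "e \<bullet> f = 0"
  shows "polar e f r s \<bullet> polar e f r' t = r * r' * cos (s - t)"
proof -
  have "e \<bullet> e = 1" "f \<bullet> f = 1" "f \<bullet> e = 0"
    using assms by (auto simp: norm_eq_1 inner_commute)
  then show ?thesis
    by (simp add: polar_def inner_add assms(3) cos_diff algebra_simps)
qed

section \<open>Monotonicity in the norm from condition (ii)\<close>

context
  fixes \<Omega> :: "'a::real_inner \<Rightarrow> 'b::linorder"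
  assumes orth: "\<And>x y. x \<bullet> y = 0 \<Longrightarrow> max (\<Omega> x) (\<Omega> y) \<le> \<Omega> (x + y)"
begin

lemma orthogonal_step:
  assumes "u \<bullet> (v - u) = 0"
  shows "\<Omega> u \<le> \<Omega> v"
  using orth[OF assms] by simp

context
  fixes e f :: 'a
  assumes e: "norm e = 1" and f: "norm f = 1" and ef: "e \<bullet> f = 0"
begin

text \<open>With \<open>u\<close> and \<open>v\<close> the two vectors,
  \<open>u \<bullet> v = r * (r / cos d) * cos d = u \<bullet> u\<close>, so \<open>v - u\<close> is
  orthogonal to \<open>u\<close>.\<close>

lemma polar_step:
  assumes "cos d \<noteq> 0"
  shows "\<Omega> (polar e f r t) \<le> \<Omega> (polar e f (r / cos d) (t + d))"
  by (rule orthogonal_step) (use assms in \<open>simp add: inner_diff_right inner_polar[OF e f ef]\<close>)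

lemma polar_steps:
  assumes "cos d \<noteq> 0"
  shows "\<Omega> (polar e f r t) \<le> \<Omega> (polar e f (r / cos d ^ n) (t + real n * d))"
proof (induction n)
  case (Suc n)
  also have "\<Omega> (polar e f (r / cos d ^ n) (t + real n * d))
      \<le> \<Omega> (polar e f (r / cos d ^ n / cos d) (t + real n * d + d))"
    using assms by (rule polar_step)
  finally show ?case
    by (simp add: algebra_simps)
qed simp

text \<open>Turning by \<open>d\<close> and then back by \<open>-d\<close> returns to the same ray
  with the length divided by \<open>cos d\<close> twice. The angle is chosen so that
  \<open>cos d * cos d = r / r'\<close>.\<close>

lemma polar_radial_mono:
  assumes "0 < r" "r \<le> r'"
  shows "\<Omega> (polar e f r t) \<le> \<Omega> (polar e f r' t)"
proof -
  define d where "d = arccos (sqrt (r / r'))"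
  have cd: "cos d = sqrt (r / r')"
    using assms by (simp add: d_def cos_arccos_abs)
  then have d0: "cos d \<noteq> 0"
    using assms by simp
  have sq: "cos d * cos d = r / r'"
    using cd assms by simp
  have "\<Omega> (polar e f r t) \<le> \<Omega> (polar e f (r / cos d) (t + d))"
    by (rule polar_step[OF d0])
  also have "\<dots> \<le> \<Omega> (polar e f (r / cos d / cos (- d)) (t + d + - d))"
    by (rule polar_step) (use d0 in simp)
  also have "r / cos d / cos (- d) = r'"
    using sq assms by simp
  finally show ?thesis by simp
qed

text \<open>Since \<open>r / r' < 1\<close>, some number \<open>n\<close> of equal steps reaches the
  angle \<theta> with length at most \<open>r'\<close>; a radial move then makes up the remaining
  length.\<close>

lemma polar_mono:
  assumes "0 < r" "r < r'"
  shows "\<Omega> (polar e f r 0) \<le> \<Omega> (polar e f r' \<theta>)"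
proof -
  obtain n where n: "n > 0" "\<bar>\<theta> / real n\<bar> \<le> 1" "r / r' \<le> cos (\<theta> / real n) ^ n"
    using ex_cos_divide_power_ge[of "r / r'" \<theta>] assms by auto
  define d where "d = \<theta> / real n"
  have "\<bar>d\<bar> \<le> 1"
    using n(2) by (simp only: d_def)
  \<comment> \<open>Here \<open>\<bar>d\<bar> \<le> 1 < pi / 2\<close>.\<close>
  then have "0 < cos d"
    using pi_gt3 by (intro cos_gt_zero_pi) linarith+
  then have c: "0 < cos d" "0 < cos d ^ n"
    by simp_all
  have "\<Omega> (polar e f r 0) \<le> \<Omega> (polar e f (r / cos d ^ n) \<theta>)"
    using polar_steps[of d r 0 n] c n(1) by (simp add: d_def)
  also have "\<dots> \<le> \<Omega> (polar e f r' \<theta>)"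
    using assms n(3) c by (intro polar_radial_mono) (auto simp: d_def field_simps)
  finally show ?thesis .
qed

end

lemma mono_norm_strict:
  assumes dim: "dim_at_least 2 (UNIV :: 'a set)" and lt: "norm x < norm y"
  shows "\<Omega> x \<le> \<Omega> y"
proof (cases "x = 0")
  case True
  \<comment> \<open>The zero vector is orthogonal to everything.\<close>
  then show ?thesis by (intro orthogonal_step) simp
next
  case False
  define e where "e = x /\<^sub>R norm x"
  have e: "norm e = 1"
    using False by (simp add: e_def)
  obtain f \<theta> where f: "norm f = 1" "e \<bullet> f = 0"
    and y: "y = polar e f (norm y) \<theta>"
    by (rule polar_form_in_plane[OF dim e])
  have "\<Omega> (polar e f (norm x) 0) \<le> \<Omega> (polar e f (norm y) \<theta>)"
    using polar_mono[OF e f] False lt by simp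
  moreover have "polar e f (norm x) 0 = x"
    using False by (simp add: polar_def e_def)
  ultimately show ?thesis by (simp flip: y)
qed

end

text \<open>If \<open>\<Omega> y < \<Omega> x\<close>, lower semicontinuity gives
  \<open>\<Omega> y < \<Omega> (r *\<^sub>R x)\<close> for \<open>r < 1\<close> close to 1. But
  \<open>r *\<^sub>R x\<close> is strictly shorter than \<open>y\<close>, so the strict case
  applies.\<close>

lemma mono_norm:
  fixes \<Omega> :: "'a::real_inner \<Rightarrow> 'b::{complete_linorder,linorder_topology}"
  assumes orth: "\<And>x y. x \<bullet> y = 0 \<Longrightarrow> max (\<Omega> x) (\<Omega> y) \<le> \<Omega> (x + y)"
    and dim: "dim_at_least 2 (UNIV :: 'a set)"
    and lsc: "lower_semicontinuous \<Omega>"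
    and le: "norm x \<le> norm y"
  shows "\<Omega> x \<le> \<Omega> y"
proof (cases "x = 0")
  case True
  then show ?thesis using orth[of x y] by simp
next
  case False
  show ?thesis
  proof (rule ccontr)
    assume "\<not> ?thesis"
    then have ev: "eventually (\<lambda>z. \<Omega> y < \<Omega> z) (at x)"
      using lower_semicontinuousD[OF lsc] by simp
    have r: "eventually (\<lambda>r::real. r \<in> {0<..<1}) (at_left 1)"
      by (rule eventually_at_leftI[of 0]) auto
    have "((\<lambda>r. r *\<^sub>R x) \<longlongrightarrow> 1 *\<^sub>R x) (at_left 1)"
      by (intro tendsto_intros)
    \<comment> \<open>The filter \<open>at x\<close> omits \<open>x\<close> itself, so the
      approaching points must differ from \<open>x\<close>.\<close>
    moreover have "eventually (\<lambda>r. r *\<^sub>R x \<noteq> x) (at_left 1)"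
      using r by eventually_elim (use False scaleR_cancel_right[of _ x 1] in auto)
    ultimately have "filterlim (\<lambda>r. r *\<^sub>R x) (at x) (at_left 1)"
      by (simp add: filterlim_at)
    with ev have "eventually (\<lambda>r. \<Omega> y < \<Omega> (r *\<^sub>R x)) (at_left 1)"
      by (rule eventually_compose_filterlim)
    with r have "eventually (\<lambda>r::real. False) (at_left 1)"
    proof eventually_elim
      case (elim r)
      then have "norm (r *\<^sub>R x) < norm x"
        using False by simp
      with le have "norm (r *\<^sub>R x) < norm y"
        by linarith
      with orth dim have "\<Omega> (r *\<^sub>R x) \<le> \<Omega> y"
        by (rule mono_norm_strict)
      with elim show False by simp
    qed
    then show False by simp
  qed
qed

section \<open>The two directions of the equivalence\<close>

theorem theorem1:
  fixes \<Omega> :: "'a::{real_inner,complete_space} \<Rightarrow> ereal"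
  assumes dim: "dim_at_least 2 (UNIV :: 'a set)"
    and not_MInf: "\<And>w. \<Omega> w \<noteq> -\<infinity>"
    and lsc: "lower_semicontinuous \<Omega>"
  shows "(\<exists>h :: real \<Rightarrow> ereal. (\<forall>t. h t \<noteq> -\<infinity>) \<and> mono h \<and> (\<forall>w. \<Omega> w = h (norm w)))
     \<longleftrightarrow> (\<forall>x y. x \<bullet> y = 0 \<longrightarrow> \<Omega> (x + y) \<ge> max (\<Omega> x) (\<Omega> y))"
proof
  assume "\<exists>h :: real \<Rightarrow> ereal. (\<forall>t. h t \<noteq> -\<infinity>) \<and> mono h \<and> (\<forall>w. \<Omega> w = h (norm w))"
  then obtain h :: "real \<Rightarrow> ereal" where h: "mono h" "\<And>w. \<Omega> w = h (norm w)"
    by blast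
  show "\<forall>x y. x \<bullet> y = 0 \<longrightarrow> \<Omega> (x + y) \<ge> max (\<Omega> x) (\<Omega> y)"
  proof (intro allI impI)
    fix x y :: 'a
    assume "x \<bullet> y = 0"
    then have "(norm (x + y))\<^sup>2 = (norm x)\<^sup>2 + (norm y)\<^sup>2"
      by (intro norm_add_Pythagorean) (simp add: orthogonal_def)
    then have "norm x \<le> norm (x + y)" "norm y \<le> norm (x + y)"
      by (auto intro: power2_le_imp_le)
    then show "\<Omega> (x + y) \<ge> max (\<Omega> x) (\<Omega> y)"
      using h by (simp add: monoD)
  qed
next
  assume "\<forall>x y. x \<bullet> y = 0 \<longrightarrow> \<Omega> (x + y) \<ge> max (\<Omega> x) (\<Omega> y)"
  then have mn: "\<Omega> x \<le> \<Omega> y" if "norm x \<le> norm y" for x y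
    using mono_norm[OF _ dim lsc that] by blast
  \<comment> \<open>A vector outside \<open>span {0}\<close> is nonzero and can be
    normalised.\<close>
  obtain u :: 'a where u: "u \<notin> span {0}"
    using ex_not_in_span_singleton[OF dim] by blast
  define e where "e = u /\<^sub>R norm u"
  have e: "norm e = 1"
    using u by (auto simp: e_def)
  \<comment> \<open>\<open>h\<close> reads \<Omega> along the ray of \<open>e\<close>. Cutting off
    at 0 makes \<open>h\<close> constant for negative \<open>t\<close>, where
    \<open>norm (t *\<^sub>R e)\<close> would decrease in \<open>t\<close>.\<close>
  define h where "h t = \<Omega> (max t 0 *\<^sub>R e)" for t
  have "mono h"
    unfolding h_def by (intro monoI mn) (auto simp: e)
  \<comment> \<open>\<open>w\<close> and \<open>norm w *\<^sub>R e\<close> have equal norms, so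
    \<open>mn\<close> applies in both directions.\<close>
  moreover have "\<Omega> w = h (norm w)" for w
    unfolding h_def by (intro antisym mn) (auto simp: e)
  moreover have "h t \<noteq> -\<infinity>" for t
    by (simp add: h_def not_MInf)
  ultimately show "\<exists>h :: real \<Rightarrow> ereal. (\<forall>t. h t \<noteq> -\<infinity>) \<and> mono h \<and> (\<forall>w. \<Omega> w = h (norm w))"
    by blast
qed

end
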